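(* Let $m\ge 2$ be an integer, let $a_1,\ldots,a_{m-1}$ be positive integers (not necessarily distinct), and let $S=\sum_{i=1}^{m-1}a_i$. Let $c$ be an integer with $S\le c\le 2S-1$ and $cS$ even. For an integer $r\ge 2$ write $\mathrm{Rad}_r(c)$ for $\mathrm{Rad}_r(a_1,\ldots,a_{m-1},-1;c)$. (i) If $c=2S-2$, then $\mathrm{Rad}_r(2S-2)=2$ for every integer $r>1$. (ii) Suppose the multiset $\{a_1,\ldots,a_{m-1}\}$ is $2$-distributable. If $c\ne 2S-2$, then $\mathrm{Rad}_2(c)\le S+1$; moreover, if $c=2S-1$, then $\mathrm{Rad}_2(2S-1)=3$.
   Context: For nonzero integers $b_1,\ldots,b_m$, an integer $c$ and an integer $r\ge 2$, the Rado number $\mathrm{Rad}_r(b_1,\ldots,b_m;c)$ is the least positive integer $N$ such that for every colouring $\chi:\{1,\ldots,N\}\to\{1,\ldots,r\}$ there exist $x_1,\ldots,x_m\in\{1,\ldots,N\}$ (not necessarily distinct) with $\sum_{i=1}^m b_ix_i=c$ and $\chi(x_1)=\cdots=\chi(x_m)$. Thus $\mathrm{Rad}_r(a_1,\ldots,a_{m-1},-1;c)$ refers to the equation $\sum_{i=1}^{m-1}a_ix_i-x_m=c$. An equality or an upper bound by a finite number includes the assertion that the Rado number exists. A multiset $\{a_1,\ldots,a_k\}$ of positive integers is $t$-distributable ($t$ a positive integer) if for every choice of nonnegative integers $\sigma_1,\ldots,\sigma_t$ with $\sum_{j=1}^t\sigma_j=\sum_{i=1}^k a_i$ there is a partition of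 the index set $\{1,\ldots,k\}$ into pairwise disjoint sets $S_1,\ldots,S_t$ (some possibly empty) such that $\sum_{i\in S_j}a_i=\sigma_j$ for every $j\in\{1,\ldots,t\}$. *)

theory Defs
  imports Complex_Main "HOL-Library.Extended_Nat" "HOL-Library.FuncSet" "HOL-Library.Disjoint_Sets"
begin

definition mono_solution ::
  "(nat \<Rightarrow> nat) \<Rightarrow> nat \<Rightarrow> int list \<Rightarrow> int \<Rightarrow> (nat \<Rightarrow> nat) \<Rightarrow> bool" where
  "mono_solution \<chi> N bs c x \<longleftrightarrow>
     x \<in> {..<length bs} \<rightarrow> {1..N} \<and>
     (\<Sum>i<length bs. bs ! i * int (x i)) = c \<and>
     (\<forall>i<length bs. \<forall>j<length bs. \<chi> (x i) = \<chi> (x j))"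

definition rado_property :: "nat \<Rightarrow> int list \<Rightarrow> int \<Rightarrow> nat \<Rightarrow> bool" where
  "rado_property r bs c N \<longleftrightarrow>
     (\<forall>\<chi> \<in> {1..N} \<rightarrow> {1..r}. \<exists>x. mono_solution \<chi> N bs c x)"

text \<open>The value is \<open>\<infinity>\<close> exactly when no such \<open>N\<close> exists (the infimum of the empty set),
  so an equation with, or an upper bound by, a finite number includes existence.\<close>

definition rado_number :: "nat \<Rightarrow> int list \<Rightarrow> int \<Rightarrow> enat" where
  "rado_number r bs c = (INF N \<in> {N. N > 0 \<and> rado_property r bs c N}. enat N)"

text \<open>A multiset is represented by a list of its elements, whose positions form the index set.\<close>

definition distributable :: "nat \<Rightarrow> nat list \<Rightarrow> bool" where
  "distributable t as \<longleftrightarrow>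
     (\<forall>\<sigma> :: nat \<Rightarrow> nat. (\<Sum>j\<in>{1..t}. \<sigma> j) = sum_list as \<longrightarrow>
        (\<exists>S :: nat \<Rightarrow> nat set.
           disjoint_family_on S {1..t} \<and>
           (\<Union>j\<in>{1..t}. S j) = {..<length as} \<and>
           (\<forall>j\<in>{1..t}. (\<Sum>i\<in>S j. as ! i) = \<sigma> j)))"

end

theory Submission
  imports Defs
begin

text \<open>Write $c = S + d$. If the coefficients form a $2$-distributable multiset and the variables
  $x_1,\ldots,x_{m-1}$ take only two values $u$ and $v$, then the total coefficient $s$ of the
  variables equal to $v$ can be any number from $0$ to $S$, so the equation turns into
  $u S + (v - u) s = c + w$ with $w = x_m$. A monochromatic solution therefore exists as
  soon as three numbers $u, v, w$ of one colour admit such an $s$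
  (\<open>mono_solution_two_values\<close>). This gives the upper bounds by chasing forced colours.

  For $d \<le> S - 3$, suppose that $\{1,\ldots,S+1\}$ has no monochromatic solution and that $1$
  is red. In the form $(u,v,w;s)$, the triple $(1,2,1;d+1)$ makes $2$ blue,
  $(2,2,S-d;0)$ makes $S-d$ red, $(1,S+1,S-d;1)$ makes $S+1$ blue, and
  $(2,3,S+1;d+1)$ makes $3$ red. So $1$, $3$ and $S-d$ are all red, and the difference
  $v - u = 2$ only leaves a parity condition. If $d$ is odd, $(1,3,1;(d+1)/2)$ is a solution;
  if $d$ is even then so is $S$, because $(S+d)S$ is even, and $(1,3,S-d;S/2)$ is a solution.

  For $c = 2S-1$ any two of $1,2,3$ that share a colour already give a solution, and for
  $c = 2S-2$ the constant $2$ is one. The lower bounds come from giving all numbers different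
  colours, which leaves only constant solutions.\<close>

section \<open>Bounding Rado numbers\<close>

lemma rado_number_le:
  assumes "N > 0" "rado_property r bs c N"
  shows "rado_number r bs c \<le> enat N"
  unfolding rado_number_def using assms by (intro INF_lower) auto

lemma rado_number_eqI:
  assumes "N > 0" "rado_property r bs c N"
    and "\<And>M. \<lbrakk>M > 0; M < N\<rbrakk> \<Longrightarrow> \<not> rado_property r bs c M"
  shows "rado_number r bs c = enat N"
proof (rule antisym[OF rado_number_le[OF assms(1,2)]])
  show "enat N \<le> rado_number r bs c"
    unfolding rado_number_def
  proof (rule INF_greatest)
    fix M assume "M \<in> {N. N > 0 \<and> rado_property r bs c N}"
    then show "enat N \<le> enat M" using assms(3)[of M] by (cases "M < N") auto
  qed
qed

text \<open>With at least $M$ colours the numbers up to $M$ can all be coloured differently, and then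
  a monochromatic solution is constant.\<close>

lemma not_rado_property_if_no_constant_solution:
  assumes "bs \<noteq> []" "M \<le> r"
    and no_const: "\<And>k. k \<in> {1..M} \<Longrightarrow> sum_list bs * int k \<noteq> c"
  shows "\<not> rado_property r bs c M"
proof
  assume "rado_property r bs c M"
  moreover have "(\<lambda>k. k) \<in> {1..M} \<rightarrow> {1..r}" using assms(2) by auto
  ultimately obtain x where x: "mono_solution (\<lambda>k. k) M bs c x"
    unfolding rado_property_def by blast
  have const: "x i = x 0" if "i < length bs" for i
    using x that assms(1) unfolding mono_solution_def by (metis length_greater_0_conv)
  have "c = (\<Sum>i<length bs. bs ! i * int (x i))"
    using x unfolding mono_solution_def by blast
  also have "\<dots> = (\<Sum>i<length bs. bs ! i * int (x 0))"
    by (intro sum.cong) (auto simp: const)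
  also have "\<dots> = sum_list bs * int (x 0)"
    by (simp add: sum_list_sum_nth sum_distrib_right atLeast0LessThan)
  finally have "sum_list bs * int (x 0) = c" by simp
  moreover have "x 0 \<in> {1..M}"
    using x assms(1) unfolding mono_solution_def by blast
  ultimately show False using no_const by blast
qed

lemma rado_property_if_constant_solution:
  assumes "k \<in> {1..N}" "sum_list bs * int k = c"
  shows "rado_property r bs c N"
proof -
  have "(\<Sum>i<length bs. bs ! i * int k) = c"
    using assms(2) by (simp add: sum_list_sum_nth sum_distrib_right atLeast0LessThan)
  then have "mono_solution \<chi> N bs c (\<lambda>_. k)" for \<chi>
    unfolding mono_solution_def using assms(1) by auto
  then show ?thesis unfolding rado_property_def by blast
qed

lemma sum_list_map_int: "sum_list (map int as) = int (sum_list as)"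
  by (induction as) auto

section \<open>Solutions with at most three values\<close>

text \<open>This is the instance \<open>\<sigma>\<^sub>1 = s\<close>, \<open>\<sigma>\<^sub>2 = S - s\<close>
  of the definition, with the partition encoded by its first block.\<close>

lemma distributable_2_subset:
  assumes "distributable 2 as" "s \<le> sum_list as"
  obtains T where "T \<subseteq> {..<length as}" "(\<Sum>i\<in>T. as ! i) = s"
proof -
  define \<sigma> where "\<sigma> j = (if j = 1 then s else sum_list as - s)" for j :: nat
  have two: "{1..2::nat} = {1,2}" by auto
  have "(\<Sum>j\<in>{1..2}. \<sigma> j) = sum_list as" unfolding two using assms(2) by (simp add: \<sigma>_def)
  then obtain T where T: "(\<Union>j\<in>{1..2::nat}. T j) = {..<length as}"
    "\<forall>j\<in>{1..2::nat}. (\<Sum>i\<in>T j. as ! i) = \<sigma> j"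
    using assms(1)[unfolded distributable_def, rule_format, of \<sigma>] by auto
  have "T 1 \<subseteq> {..<length as}" using T(1) by auto
  moreover have "(\<Sum>i\<in>T 1. as ! i) = s" using T(2) by (auto simp: \<sigma>_def)
  ultimately show thesis using that by blast
qed

lemma mono_solution_two_values:
  assumes dist: "distributable 2 as" and s: "s \<le> sum_list as"
    and range: "u \<in> {1..N}" "v \<in> {1..N}" "w \<in> {1..N}"
    and col: "\<chi> v = \<chi> u" "\<chi> w = \<chi> u"
    and eq: "int u * int (sum_list as) + (int v - int u) * int s = c + int w"
  shows "\<exists>x. mono_solution \<chi> N (map int as @ [-1]) c x"
proof -
  obtain T where T: "T \<subseteq> {..<length as}" "(\<Sum>i\<in>T. as ! i) = s"
    using distributable_2_subset[OF dist s] by blast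
  define x where "x i = (if i \<in> T then v else if i < length as then u else w)" for i
  have "(\<Sum>i<length as. int (as ! i) * int (x i))
      = (\<Sum>i<length as. int u * int (as ! i) +
          (if i \<in> T then (int v - int u) * int (as ! i) else 0))"
    by (intro sum.cong) (auto simp: x_def algebra_simps)
  also have "\<dots> = int u * (\<Sum>i<length as. int (as ! i)) +
      (\<Sum>i\<in>{..<length as} \<inter> T. (int v - int u) * int (as ! i))"
    by (simp add: sum.distrib sum_distrib_left sum.inter_restrict)
  also have "{..<length as} \<inter> T = T" using T(1) by auto
  also have "(\<Sum>i\<in>T. (int v - int u) * int (as ! i)) = (int v - int u) * int s"
    by (simp add: T(2)[symmetric] sum_distrib_left)
  also have "(\<Sum>i<length as. int (as ! i)) = int (sum_list as)"
    by (simp add: sum_list_sum_nth atLeast0LessThan)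
  finally have sum_x: "(\<Sum>i<length as. int (as ! i) * int (x i)) = c + int w"
    using eq by simp
  have x_last: "x (length as) = w" using T(1) by (auto simp: x_def)
  have "(\<Sum>i<length as. (map int as @ [-1]) ! i * int (x i)) = c + int w"
    unfolding sum_x[symmetric] by (intro sum.cong) (auto simp: nth_append)
  then have "(\<Sum>i<length (map int as @ [-1]). (map int as @ [-1]) ! i * int (x i)) = c"
    by (simp add: x_last nth_append)
  moreover have "x i \<in> {1..N}" "\<chi> (x i) = \<chi> u" for i
    using range col by (auto simp: x_def)
  ultimately show ?thesis unfolding mono_solution_def by (intro exI[of _ x]) auto
qed

section \<open>Two colours\<close>

text \<open>The number $3$ is reached because each of the pairs $\{1,2\}$, $\{1,3\}$, $\{2,3\}$ supports
  a solution; only the pair $\{1,3\}$ needs $S$ to be even.\<close>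

lemma rado_property_two_colours_3:
  assumes dist: "distributable 2 as" and S: "S = sum_list as" "S > 0" "even S"
  shows "rado_property 2 (map int as @ [-1]) (2 * int S - 1) 3"
  unfolding rado_property_def
proof
  fix \<chi> :: "nat \<Rightarrow> nat" assume \<chi>: "\<chi> \<in> {1..3} \<rightarrow> {1..2}"
  note sol = mono_solution_two_values[OF dist, folded S(1), where c = "2 * int S - 1"]
  obtain h where h: "S = 2 * h" using S(3) by blast
  have "\<chi> k = 1 \<or> \<chi> k = 2" if "k \<in> {1..3}" for k
    using funcset_mem[OF \<chi> that] by auto
  from this[of 1] this[of 2] this[of 3]
  consider "\<chi> 2 = \<chi> 1" | "\<chi> 3 = \<chi> 1" | "\<chi> 3 = \<chi> 2" by fastforce
  then show "\<exists>x. mono_solution \<chi> 3 (map int as @ [-1]) (2 * int S - 1) x"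
  proof cases
    case 1
    then show ?thesis by (intro sol[of S 1 _ 2 1]) auto
  next
    case 2
    then show ?thesis using h by (intro sol[of h 1 _ 3 1]) auto
  next
    case 3
    then show ?thesis using S(2) by (intro sol[of 1 2 _ 3 2]) auto
  qed
qed

text \<open>Each assumption $\chi(k) = \ldots$ that is refuted below forces the colour of one more number,
  until $1$, $3$ and $S - d$ share a colour; parity enters only then.\<close>

lemma rado_property_two_colours_Suc_sum:
  assumes dist: "distributable 2 as" and S: "S = sum_list as" and d: "d + 3 \<le> S"
    and parity: "odd d \<or> even S"
  shows "rado_property 2 (map int as @ [-1]) (int S + int d) (S + 1)"
  unfolding rado_property_def
proof
  fix \<chi> :: "nat \<Rightarrow> nat" assume \<chi>: "\<chi> \<in> {1..S + 1} \<rightarrow> {1..2}"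
  note sol = mono_solution_two_values[OF dist, folded S, where N = "S + 1" and \<chi> = \<chi> and c = "int S + int d"]
  have two: "\<chi> k = 1 \<or> \<chi> k = 2" if "k \<in> {1..S + 1}" for k
    using funcset_mem[OF \<chi> that] by auto
  have red: "\<chi> k = \<chi> 1" if "\<chi> 2 \<noteq> \<chi> 1" "\<chi> k \<noteq> \<chi> 2" "k \<in> {1..S + 1}" for k
    using two[of 1] two[of 2] two[of k] that d by auto
  have range: "S - d \<in> {1..S + 1}" using d by auto
  \<comment> \<open>By symmetry of the two colours, red is the colour of $1$.\<close>
  show "\<exists>x. mono_solution \<chi> (S + 1) (map int as @ [-1]) (int S + int d) x"
  proof (rule ccontr)
    assume none: "\<not> ?thesis"
    have 2: "\<chi> 2 \<noteq> \<chi> 1"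
    proof
      assume "\<chi> 2 = \<chi> 1"
      then show False using none sol[of "d + 1" 1 2 1] d by auto
    qed
    have "\<chi> (S - d) \<noteq> \<chi> 2"
    proof
      assume "\<chi> (S - d) = \<chi> 2"
      then show False using none sol[of 0 2 2 "S - d"] d range by (auto simp: of_nat_diff)
    qed
    then have S_d: "\<chi> (S - d) = \<chi> 1" using red 2 range by blast
    have "\<chi> (S + 1) \<noteq> \<chi> 1"
    proof
      assume "\<chi> (S + 1) = \<chi> 1"
      then show False using none S_d sol[of 1 1 "S + 1" "S - d"] d range by (auto simp: of_nat_diff)
    qed
    then have S_1: "\<chi> (S + 1) = \<chi> 2" using red[of "S + 1"] 2 by auto
    have "\<chi> 3 \<noteq> \<chi> 2"
    proof
      assume "\<chi> 3 = \<chi> 2"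
      then show False using none S_1 sol[of "d + 1" 2 3 "S + 1"] d by auto
    qed
    then have 3: "\<chi> 3 = \<chi> 1" using red[of 3] 2 d by auto
    show False
    proof (cases "odd d")
      case True
      then obtain h where h: "d = 2 * h + 1" by (elim oddE)
      have "h + 1 \<le> S" using h d by linarith
      then show False using none 3 sol[of "h + 1" 1 3 1] d by (auto simp: h)
    next
      case False
      then have "even S" using parity by blast
      then obtain h where h: "S = 2 * h" by (elim evenE)
      have "int 1 * int S + (int 3 - int 1) * int h = int S + int d + int (S - d)"
        using d by (simp add: of_nat_diff h)
      moreover have "h \<le> S" "(1::nat) \<in> {1..S + 1}" "3 \<in> {1..S + 1}" using h d by auto
      ultimately show False using none sol[of h 1 3 "S - d"] range 3 S_d by blast
    qed
  qed
qed

theorem theorem12: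
  fixes m S :: nat and as :: "nat list" and c :: int
  assumes "m \<ge> 2"
    and "length as = m - 1"
    and "\<forall>a \<in> set as. a > 0"
    and "S = sum_list as"
    and "int S \<le> c"
    and "c \<le> 2 * int S - 1"
    and "even (c * int S)"
  shows "(c = 2 * int S - 2 \<longrightarrow>
            (\<forall>r > 1. rado_number r (map int as @ [-1]) (2 * int S - 2) = 2)) \<and>
         (distributable 2 as \<and> c \<noteq> 2 * int S - 2 \<longrightarrow>
            rado_number 2 (map int as @ [-1]) c \<le> enat (S + 1) \<and>
            (c = 2 * int S - 1 \<longrightarrow>
               rado_number 2 (map int as @ [-1]) (2 * int S - 1) = 3))"
proof -
  let ?bs = "map int as @ [-1]"
  have sum_as: "sum_list (map int as) = int S" using assms(4) by (simp add: sum_list_map_int)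
  have S_pos: "S > 0" using assms(5,6) by linarith
  have part_i: "rado_number r ?bs (2 * int S - 2) = enat 2"
    if "c = 2 * int S - 2" "r > 1" for r
  proof (rule rado_number_eqI)
    show "rado_property r ?bs (2 * int S - 2) 2"
      by (rule rado_property_if_constant_solution[of 2]) (auto simp: sum_as)
  next
    fix M :: nat assume "0 < M" "M < 2"
    then have "M = 1" by simp
    \<comment> \<open>The constant $1$ would need $S = 1$, but $S \<le> c = 2 S - 2$.\<close>
    then show "\<not> rado_property r ?bs (2 * int S - 2) M"
      using that assms(5)
      by (intro not_rado_property_if_no_constant_solution) (auto simp: sum_as)
  qed simp
  have eq_3: "rado_number 2 ?bs (2 * int S - 1) = enat 3"
    if "distributable 2 as" "c = 2 * int S - 1"
  proof (rule rado_number_eqI)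
    have "even S" using assms(7) that(2) by auto
    then show "rado_property 2 ?bs (2 * int S - 1) 3"
      using that(1) assms(4) S_pos rado_property_two_colours_3 by blast
  next
    fix M :: nat assume M: "0 < M" "M < 3"
    have "(int S - 1) * int k \<noteq> 2 * int S - 1" if "k \<in> {1..M}" for k
    proof -
      have "k = 1 \<or> k = 2" using that M by auto
      then show ?thesis using S_pos by auto
    qed
    then show "\<not> rado_property 2 ?bs (2 * int S - 1) M"
      using M by (intro not_rado_property_if_no_constant_solution) (auto simp: sum_as)
  qed simp
  have le: "rado_number 2 ?bs c \<le> enat (S + 1)"
    if dist: "distributable 2 as" and "c \<noteq> 2 * int S - 2"
  proof (cases "c = 2 * int S - 1")
    case True
    then have "even S" using assms(7) by auto
    then have "S \<ge> 2" using S_pos by (auto elim: evenE)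
    then show ?thesis using eq_3[OF dist True] True by simp
  next
    case False
    define d where "d = nat (c - int S)"
    have c: "c = int S + int d" using assms(5) by (simp add: d_def)
    have "d + 3 \<le> S" using c False that(2) assms(6) by linarith
    moreover have "odd d \<or> even S" using assms(7) by (auto simp: c)
    ultimately show ?thesis
      unfolding c using dist assms(4)
      by (intro rado_number_le rado_property_two_colours_Suc_sum) auto
  qed
  show ?thesis using part_i eq_3 le by (simp add: numeral_eq_enat)
qed

end
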